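(* Consider the power network system (S) described in the context, and let $(\eta^*,\omega^*,x^{M,*},x^{c,*},x^{u,*})$ be an equilibrium of (S), with corresponding values $p^{M,*}_j=k_{p^M_j}(-\omega^*_j)$ ($j\in G$), $d^{c,*}_j=k_{d^c_j}(-\omega_j^* )$ and $d^{u,*}_j=k_{d^u_j}(-\omega_j^* )$ ($j\in N$). Suppose that the cost functions $C_j$ ($j\in G$) and $C_{dj}$ ($j\in N$) are continuously differentiable and strictly convex, and that the first derivative of $h_j^{-1}(z)$ is nonnegative for all $z\in\mathbb R$ and all $j\in N$. If the dynamics of generation and controllable demand are chosen such that $$k_{p^M_j}(-\omega_j^* )=\big[(C_j')^{-1}(-\omega_j^* )\big]^{p^{M,max}_j}_{p^{M,min}_j}\ (j\in G),\qquad k_{d^c_j}(-\omega_j^* )=\big[(C_{dj}')^{-1}(\omega_j^* )\big]^{d^{c,max}_j}_{d^{c,min}_j}\ (j\in N),$$ then the values $p^{M,*},d^{c,*},d^{u,*}$ are optimal for the optimization problem OSLC defined in the context.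
   Context: **Notation.** $[q]^b_a:=\max\{\min\{q,b\},a\}$ for $a\le b$; $f'$ is the derivative of $f$, and $f^{-1}$ its inverse function. **Input-output systems.** All subsystems are of the form $\dot x=f(x,u)$, $y=g(x,u)$ with input $u(t)\in\mathbb R$, state $x(t)\in\mathbb R^m$, output $y(t)\in\mathbb R$, $f$ locally Lipschitz and $g$ continuous. For every constant input $u\equiv\bar u\in\mathbb R$ there is a unique locally asymptotically stable equilibrium point $\bar x$ (so $f(\bar x,\bar u)=0$, and $\bar x$ is the unique equilibrium point for that input). The static input-state characteristic is $k_x(\bar u):=\bar x$ and the static input-output characteristic is $k_y(\bar u):=g(k_x(\bar u),\bar u)$. **Network.** $(N,E)$ is a finite connected directed graph with arbitrary orientation ($(i,j)\in E\Rightarrow (j,i)\notin E$); $N$ is partitioned into generation buses $G=\{1,\dots,|G|\}$ and load buses $L=\{|G|+1,\dots,|N|\}$. $i:i\to j$ and $k:j\to k$ denote predecessors and successors of $j$. Constants: $M_j>0$ ($j\in G$), $B_{ij}>0$ and $p^{nom}_{ij}\in\mathbb R$ ($(i,j)\in E$), $p^L_j\in\mathbb R$ ($j\in N$). **System (S).** $$\dot\eta_{ij}=\omega_i-\omega_j,\quad (i,j)\in E,$$ $$M_j\dot\omega_j=-p^L_j+p^M_j-(d^c_j+d^u_j)-\sum_{k:j\to k}p_{jk}+\sum_{i:i\to j}p_{ij},\quad j\in G,$$ $$0=-p^L_j-(d^c_j+d^u_j)-\sum_{k:j\to k}p_{jk}+\sum_{i:i\to j}p_{ij},\quad j\in L,$$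 $$p_{ij}=B_{ij}\sin\eta_{ij}-p^{nom}_{ij},\quad (i,j)\in E,$$ where $p^M_j$ ($j\in G$, generation), $d^c_j$ ($j\in N$, controllable demand) and $d^u_j$ ($j\in N$, uncontrollable frequency-dependent demand) are outputs of independent systems of the form $\dot x=f(x,u)$, $y=g(x,u)$ (with $f$ locally Lipschitz, $g$ continuous, and a unique locally asymptotically stable equilibrium point for every constant input) with input $-\omega_j$ and states $x^{M,j},x^{c,j},x^{u,j}$ respectively. **Equilibrium.** Constants $(\eta^*,\omega^*,x^{M,*},x^{c,*},x^{u,*})$ form an equilibrium of (S) if $\omega^*_i=\omega^*_j$ for $(i,j)\in E$; $0=-p^L_j+p^{M,*}_j-(d^{c,*}_j+d^{u,*}_j)-\sum_{k:j\to k}p^*_{jk}+\sum_{i:i\to j}p^*_{ij}$ for $j\in G$; $0=-p^L_j-(d^{c,*}_j+d^{u,*}_j)-\sum_{k:j\to k}p^*_{jk}+\sum_{i:i\to j}p^*_{ij}$ for $j\in L$; $x^{M,j,*}=k_{x^{M,j}}(-\omega^*_j)$ ($j\in G$), $x^{c,j,*}=k_{x^{c,j}}(-\omega_j^* )$, $x^{u,j,*}=k_{x^{u,j}}(-\omega_j^* )$ ($j\in N$); where $p^*_{ij}=B_{ij}\sin\eta^*_{ij}-p^{nom}_{ij}$, $p^{M,*}_j=k_{p^M_j}(-\omega_j^* )$, $d^{c,*}_j=k_{d^c_j}(-\omega_j^* )$, $d^{u,*}_j=k_{d^u_j}(-\omega_j^* )$. **OSLC problem.** Let $h_j(z):=k_{d^u_j}(-z)$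 for $z\in\mathbb R$, $j\in N$ (taken invertible with differentiable inverse $h_j^{-1}$ on $\mathbb R$, as implicit in the hypothesis on $h_j^{-1}$). Given cost functions $C_j,C_{dj}:\mathbb R\to\mathbb R$ and bounds $p^{M,min}_j\le p^{M,max}_j$, $d^{c,min}_j\le d^{c,max}_j$, OSLC is $$\min_{p^M,d^c,d^u}\ \sum_{j\in G}C_j(p^M_j)+\sum_{j\in N}\Big(C_{dj}(d^c_j)+\int_0^{d^u_j}h_j^{-1}(z)\,dz\Big)$$ subject to $\sum_{j\in G}p^M_j=\sum_{j\in N}(d^c_j+d^u_j+p^L_j)$, $\ p^{M,min}_j\le p^M_j\le p^{M,max}_j$ for all $j\in G$, $\ d^{c,min}_j\le d^c_j\le d^{c,max}_j$ for all $j\in N$. "Optimal" means a global minimizer. The inverses $(C_j')^{-1}$, $(C_{dj}')^{-1}$ exist on the ranges of $C_j'$, $C_{dj}'$ by strict convexity and are understood to be defined at the points where they are evaluated. *)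

theory Defs
  imports "HOL-Analysis.Analysis"
begin

section \<open>Input-output systems\<close>

text \<open>
  The state dimension may differ from one subsystem to another, so \<open>\<real>\<^sup>m\<close> is the carrier of
  \<^const>\<open>Euclidean_space\<close>, i.e. the sequences \<open>x :: nat \<Rightarrow> real\<close> with \<open>x i = 0\<close> for \<open>i \<ge> m\<close>.
\<close>

record io_system =
  dim :: nat
  vf :: "(nat \<Rightarrow> real) \<Rightarrow> real \<Rightarrow> (nat \<Rightarrow> real)"
  outp :: "(nat \<Rightarrow> real) \<Rightarrow> real \<Rightarrow> real"

definition states :: "io_system \<Rightarrow> (nat \<Rightarrow> real) set" where
  "states S = topspace (Euclidean_space (dim S))"

definition sdist :: "io_system \<Rightarrow> (nat \<Rightarrow> real) \<Rightarrow> (nat \<Rightarrow> real) \<Rightarrow> real" where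
  "sdist S x y = L2_set (\<lambda>i. x i - y i) {..<dim S}"

definition io_solution :: "io_system \<Rightarrow> real set \<Rightarrow> (real \<Rightarrow> real) \<Rightarrow> (real \<Rightarrow> nat \<Rightarrow> real) \<Rightarrow> bool" where
  "io_solution S I u x \<longleftrightarrow>
     (\<forall>t\<in>I. x t \<in> states S \<and>
        (\<forall>i<dim S. ((\<lambda>s. x s i) has_real_derivative vf S (x t) (u t) i) (at t within I)))"

definition io_equilibrium :: "io_system \<Rightarrow> real \<Rightarrow> (nat \<Rightarrow> real) \<Rightarrow> bool" where
  "io_equilibrium S u x \<longleftrightarrow> x \<in> states S \<and> vf S x u = (\<lambda>i. 0)"

text \<open>
  Stability is required of solutions on every interval \<open>[0,T)\<close>, so that solutions escaping in
  finite time are not ignored; solutions starting close to the equilibrium then extend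
  to \<open>[0,\<infinity>)\<close>, where attractivity is stated.
\<close>

definition locally_asymptotically_stable :: "io_system \<Rightarrow> real \<Rightarrow> (nat \<Rightarrow> real) \<Rightarrow> bool" where
  "locally_asymptotically_stable S u x \<longleftrightarrow>
     (\<forall>\<epsilon>>0. \<exists>\<delta>>0. \<forall>T>0. \<forall>\<xi>. io_solution S {0..<T} (\<lambda>_. u) \<xi> \<and> sdist S (\<xi> 0) x < \<delta> \<longrightarrow>
        (\<forall>t\<in>{0..<T}. sdist S (\<xi> t) x < \<epsilon>)) \<and>
     (\<exists>\<delta>>0. \<forall>\<xi>. io_solution S {0..} (\<lambda>_. u) \<xi> \<and> sdist S (\<xi> 0) x < \<delta> \<longrightarrow>
        ((\<lambda>t. sdist S (\<xi> t) x) \<longlongrightarrow> 0) at_top)"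

definition vf_locally_lipschitz :: "io_system \<Rightarrow> bool" where
  "vf_locally_lipschitz S \<longleftrightarrow>
     (\<forall>x\<in>states S. \<forall>u. \<exists>r>0. \<exists>K\<ge>0. \<forall>y\<in>states S. \<forall>z\<in>states S. \<forall>v w.
        sdist S y x < r \<and> sdist S z x < r \<and> \<bar>v - u\<bar> < r \<and> \<bar>w - u\<bar> < r \<longrightarrow>
        sdist S (vf S y v) (vf S z w) \<le> K * (sdist S y z + \<bar>v - w\<bar>))"

definition admissible_io_system :: "io_system \<Rightarrow> bool" where
  "admissible_io_system S \<longleftrightarrow>
     (\<forall>x\<in>states S. \<forall>u. vf S x u \<in> states S) \<and>
     vf_locally_lipschitz S \<and>
     continuous_map (prod_topology (Euclidean_space (dim S)) euclideanreal) euclideanreal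
       (\<lambda>(x, u). outp S x u) \<and>
     (\<forall>u. \<exists>x. io_equilibrium S u x \<and> locally_asymptotically_stable S u x \<and>
        (\<forall>y. io_equilibrium S u y \<longrightarrow> y = x))"

definition k_x :: "io_system \<Rightarrow> real \<Rightarrow> (nat \<Rightarrow> real)" where
  "k_x S u = (THE x. io_equilibrium S u x)"

definition k_y :: "io_system \<Rightarrow> real \<Rightarrow> real" where
  "k_y S u = outp S (k_x S u) u"


section \<open>The power network\<close>

record network =
  nbus :: nat
  ngen :: nat
  edges :: "(nat \<times> nat) set"
  inertia :: "nat \<Rightarrow> real"
  coupling :: "nat \<times> nat \<Rightarrow> real"
  p_nom :: "nat \<times> nat \<Rightarrow> real"
  p_load :: "nat \<Rightarrow> real"
  gen_sys :: "nat \<Rightarrow> io_system"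
  cdem_sys :: "nat \<Rightarrow> io_system"
  udem_sys :: "nat \<Rightarrow> io_system"

definition buses :: "network \<Rightarrow> nat set" where
  "buses P = {1..nbus P}"

definition gen_buses :: "network \<Rightarrow> nat set" where
  "gen_buses P = {1..ngen P}"

definition load_buses :: "network \<Rightarrow> nat set" where
  "load_buses P = {ngen P + 1..nbus P}"

definition power_network :: "network \<Rightarrow> bool" where
  "power_network P \<longleftrightarrow>
     1 \<le> nbus P \<and> ngen P \<le> nbus P \<and>
     edges P \<subseteq> buses P \<times> buses P \<and>
     (\<forall>i j. (i, j) \<in> edges P \<longrightarrow> (j, i) \<notin> edges P) \<and>
     (\<forall>i\<in>buses P. \<forall>j\<in>buses P. (i, j) \<in> (edges P \<union> (edges P)\<inverse>)\<^sup>*) \<and>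
     (\<forall>j\<in>gen_buses P. 0 < inertia P j) \<and>
     (\<forall>e\<in>edges P. 0 < coupling P e) \<and>
     (\<forall>j\<in>gen_buses P. admissible_io_system (gen_sys P j)) \<and>
     (\<forall>j\<in>buses P. admissible_io_system (cdem_sys P j) \<and> admissible_io_system (udem_sys P j))"

definition line_flow :: "network \<Rightarrow> (nat \<times> nat \<Rightarrow> real) \<Rightarrow> nat \<times> nat \<Rightarrow> real" where
  "line_flow P \<eta> e = coupling P e * sin (\<eta> e) - p_nom P e"

definition net_inflow :: "network \<Rightarrow> (nat \<times> nat \<Rightarrow> real) \<Rightarrow> nat \<Rightarrow> real" where
  "net_inflow P p j = - (\<Sum>k | (j, k) \<in> edges P. p (j, k)) + (\<Sum>i | (i, j) \<in> edges P. p (i, j))"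

text \<open>The differential-algebraic network dynamics on a time interval \<open>I\<close>; \<open>network_equilibrium_solution\<close>
  below shows that equilibria are constant solutions.\<close>

definition network_solution ::
  "network \<Rightarrow> real set \<Rightarrow> (real \<Rightarrow> nat \<times> nat \<Rightarrow> real) \<Rightarrow> (real \<Rightarrow> nat \<Rightarrow> real) \<Rightarrow>
    (nat \<Rightarrow> real \<Rightarrow> nat \<Rightarrow> real) \<Rightarrow> (nat \<Rightarrow> real \<Rightarrow> nat \<Rightarrow> real) \<Rightarrow> (nat \<Rightarrow> real \<Rightarrow> nat \<Rightarrow> real) \<Rightarrow> bool"
where
  "network_solution P I \<eta> \<omega> xM xc xu \<longleftrightarrow>
     (let pM = (\<lambda>t j. outp (gen_sys P j) (xM j t) (- \<omega> t j));
          dc = (\<lambda>t j. outp (cdem_sys P j) (xc j t) (- \<omega> t j));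
          du = (\<lambda>t j. outp (udem_sys P j) (xu j t) (- \<omega> t j));
          p = (\<lambda>t. line_flow P (\<eta> t))
      in
       (\<forall>t\<in>I. \<forall>(i, j)\<in>edges P.
          ((\<lambda>s. \<eta> s (i, j)) has_real_derivative \<omega> t i - \<omega> t j) (at t within I)) \<and>
       (\<forall>t\<in>I. \<forall>j\<in>gen_buses P.
          ((\<lambda>s. \<omega> s j) has_real_derivative
             (- p_load P j + pM t j - (dc t j + du t j) + net_inflow P (p t) j) / inertia P j)
           (at t within I)) \<and>
       (\<forall>t\<in>I. \<forall>j\<in>load_buses P.
          0 = - p_load P j - (dc t j + du t j) + net_inflow P (p t) j) \<and>
       (\<forall>j\<in>gen_buses P. io_solution (gen_sys P j) I (\<lambda>t. - \<omega> t j) (xM j)) \<and>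
       (\<forall>j\<in>buses P. io_solution (cdem_sys P j) I (\<lambda>t. - \<omega> t j) (xc j)) \<and>
       (\<forall>j\<in>buses P. io_solution (udem_sys P j) I (\<lambda>t. - \<omega> t j) (xu j)))"

definition network_equilibrium ::
  "network \<Rightarrow> (nat \<times> nat \<Rightarrow> real) \<Rightarrow> (nat \<Rightarrow> real) \<Rightarrow>
    (nat \<Rightarrow> nat \<Rightarrow> real) \<Rightarrow> (nat \<Rightarrow> nat \<Rightarrow> real) \<Rightarrow> (nat \<Rightarrow> nat \<Rightarrow> real) \<Rightarrow> bool"
where
  "network_equilibrium P \<eta> \<omega> xM xc xu \<longleftrightarrow>
     (let pM = (\<lambda>j. k_y (gen_sys P j) (- \<omega> j));
          dc = (\<lambda>j. k_y (cdem_sys P j) (- \<omega> j));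
          du = (\<lambda>j. k_y (udem_sys P j) (- \<omega> j));
          p = line_flow P \<eta>
      in
       (\<forall>(i, j)\<in>edges P. \<omega> i = \<omega> j) \<and>
       (\<forall>j\<in>gen_buses P. 0 = - p_load P j + pM j - (dc j + du j) + net_inflow P p j) \<and>
       (\<forall>j\<in>load_buses P. 0 = - p_load P j - (dc j + du j) + net_inflow P p j) \<and>
       (\<forall>j\<in>gen_buses P. xM j = k_x (gen_sys P j) (- \<omega> j)) \<and>
       (\<forall>j\<in>buses P. xc j = k_x (cdem_sys P j) (- \<omega> j)) \<and>
       (\<forall>j\<in>buses P. xu j = k_x (udem_sys P j) (- \<omega> j)))"

lemma io_equilibrium_k_x:
  assumes "admissible_io_system S"
  shows "io_equilibrium S u (k_x S u)"
proof -
  obtain x where "io_equilibrium S u x" "\<And>y. io_equilibrium S u y \<Longrightarrow> y = x"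
    using assms unfolding admissible_io_system_def by metis
  then show ?thesis
    unfolding k_x_def by (metis theI)
qed

lemma io_solution_const:
  assumes "admissible_io_system S"
  shows "io_solution S I (\<lambda>_. u) (\<lambda>_. k_x S u)"
  using io_equilibrium_k_x[OF assms, of u]
  unfolding io_solution_def io_equilibrium_def by simp

lemma network_equilibrium_solution:
  assumes "power_network P" and "network_equilibrium P \<eta> \<omega> xM xc xu"
  shows "network_solution P I (\<lambda>_. \<eta>) (\<lambda>_. \<omega>) (\<lambda>j _. xM j) (\<lambda>j _. xc j) (\<lambda>j _. xu j)"
proof -
  have gen: "j \<in> buses P" if "j \<in> gen_buses P" for j
    using that assms(1) by (auto simp: gen_buses_def buses_def power_network_def)
  have load: "j \<in> buses P" if "j \<in> load_buses P" for j
    using that by (auto simp: load_buses_def buses_def)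
  show ?thesis
    using assms
    unfolding network_solution_def network_equilibrium_def power_network_def Let_def
    by (auto simp: k_y_def io_solution_const gen load dest: sym)
qed


section \<open>The OSLC problem\<close>

record oslc_data =
  gen_cost :: "nat \<Rightarrow> real \<Rightarrow> real"
  dem_cost :: "nat \<Rightarrow> real \<Rightarrow> real"
  pM_min :: "nat \<Rightarrow> real"
  pM_max :: "nat \<Rightarrow> real"
  dc_min :: "nat \<Rightarrow> real"
  dc_max :: "nat \<Rightarrow> real"

definition h :: "network \<Rightarrow> nat \<Rightarrow> real \<Rightarrow> real" where
  "h P j z = k_y (udem_sys P j) (- z)"

definition oslc_cost ::
  "network \<Rightarrow> oslc_data \<Rightarrow> (nat \<Rightarrow> real) \<times> (nat \<Rightarrow> real) \<times> (nat \<Rightarrow> real) \<Rightarrow> real" where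
  "oslc_cost P Q = (\<lambda>(pM, dc, du).
     (\<Sum>j\<in>gen_buses P. gen_cost Q j (pM j)) +
     (\<Sum>j\<in>buses P. dem_cost Q j (dc j) + (LBINT z=0..ereal (du j). inv (h P j) z)))"

definition oslc_feasible ::
  "network \<Rightarrow> oslc_data \<Rightarrow> (nat \<Rightarrow> real) \<times> (nat \<Rightarrow> real) \<times> (nat \<Rightarrow> real) \<Rightarrow> bool" where
  "oslc_feasible P Q = (\<lambda>(pM, dc, du).
     (\<Sum>j\<in>gen_buses P. pM j) = (\<Sum>j\<in>buses P. dc j + du j + p_load P j) \<and>
     (\<forall>j\<in>gen_buses P. pM_min Q j \<le> pM j \<and> pM j \<le> pM_max Q j) \<and>
     (\<forall>j\<in>buses P. dc_min Q j \<le> dc j \<and> dc j \<le> dc_max Q j))"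

text \<open>\<^const>\<open>is_arg_min\<close> over a real-valued cost says precisely: feasible and of minimal cost.\<close>

definition oslc_optimal ::
  "network \<Rightarrow> oslc_data \<Rightarrow> (nat \<Rightarrow> real) \<Rightarrow> (nat \<Rightarrow> real) \<Rightarrow> (nat \<Rightarrow> real) \<Rightarrow> bool" where
  "oslc_optimal P Q pM dc du \<longleftrightarrow> is_arg_min (oslc_cost P Q) (oslc_feasible P Q) (pM, dc, du)"

definition strictly_convex :: "(real \<Rightarrow> real) \<Rightarrow> bool" where
  "strictly_convex f \<longleftrightarrow>
     (\<forall>x y t. x \<noteq> y \<and> 0 < t \<and> t < 1 \<longrightarrow>
        f ((1 - t) * x + t * y) < (1 - t) * f x + t * f y)"

text \<open>\<open>sat a b q\<close> is \<open>[q]\<^sup>b\<^sub>a\<close>.\<close>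

definition sat :: "real \<Rightarrow> real \<Rightarrow> real \<Rightarrow> real" where
  "sat a b q = max (min q b) a"

end

theory Submission
  imports Defs
begin

text \<open>
  OSLC is a convex problem with a single coupling constraint, and the common equilibrium frequency
  is a Lagrange multiplier for it. Since the network is connected, \<open>\<omega>\<close> takes one value \<open>w\<close> on all
  buses. Adding \<open>w\<close> times the supply surplus (generation minus demand, zero at feasible points) to
  the cost splits it, up to a constant from the fixed loads, into independent scalar terms:
  \<open>C\<^sub>j p + w p\<close> for generation, \<open>C\<^sub>d\<^sub>j d - w d\<close> for controllable demand, and
  \<open>\<integral>\<^sub>0\<^sup>u h\<^sub>j\<^sup>-\<^sup>1 - w u\<close> for uncontrollable demand (\<open>lagrangian_optimal\<close>).

  Each term is convex, so it is globally minimised where its derivative vanishes, that is, where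
  the marginal cost is \<open>- w\<close> or \<open>w\<close> (\<open>convex_min_at_slope\<close>). Clamping that point to the admissible
  interval gives the constrained minimiser (\<open>convex_min_at_sat\<close>), which is the prescribed static
  characteristic of generation and controllable demand. The uncontrollable demand satisfies
  \<open>d\<^sup>u\<^sub>j = h\<^sub>j w\<close>, so its marginal cost \<open>h\<^sub>j\<^sup>-\<^sup>1 (d\<^sup>u\<^sub>j)\<close> is \<open>w\<close> already. Finally, the equilibrium is feasible
  because line flows cancel when the bus balances are added up (\<open>sum_net_inflow\<close>).
\<close>

section \<open>Minimising one convex cost\<close>

lemma strictly_convex_imp_convex_on:
  assumes "strictly_convex f"
  shows "convex_on UNIV f"
proof (rule convex_onI)
  fix t x y :: real
  assume t: "0 < t" "t < 1"
  show "f ((1 - t) *\<^sub>R x + t *\<^sub>R y) \<le> (1 - t) * f x + t * f y"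
  proof (cases "x = y")
    case True
    then show ?thesis
      by (simp add: algebra_simps)
  next
    case False
    then show ?thesis
      using assms t unfolding strictly_convex_def by (auto intro: less_imp_le)
  qed
qed simp

text \<open>The graph of \<open>f\<close> lies above its tangent of slope \<open>c\<close> at \<open>q\<close>, so tilting by \<open>c\<close> makes \<open>q\<close> a
  minimiser.\<close>

lemma convex_min_at_slope:
  fixes f :: "real \<Rightarrow> real"
  assumes "convex_on UNIV f" and "(f has_real_derivative c) (at q)"
  shows "f q - c * q \<le> f x - c * x"
proof -
  have "c * (x - q) \<le> f x - f q"
    by (rule convex_on_imp_above_tangent[OF assms(1)])
      (use assms(2) in simp_all)
  then show ?thesis
    by (simp add: algebra_simps)
qed

text \<open>If \<open>q\<close> lies outside \<open>[a, b]\<close>, the clamped point is between \<open>q\<close> and any \<open>x\<close> in the interval;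
  a convex function is there at most the larger of its values at \<open>q\<close> and \<open>x\<close>.\<close>

lemma convex_min_at_sat:
  fixes f :: "real \<Rightarrow> real"
  assumes conv: "convex_on UNIV f"
    and min: "\<And>x. f q \<le> f x"
    and x: "a \<le> x" "x \<le> b"
  shows "f (sat a b q) \<le> f x"
proof -
  have "sat a b q = q \<or> sat a b q \<in> closed_segment q x"
    using x by (auto simp: sat_def closed_segment_eq_real_ivl max_def min_def)
  then show ?thesis
  proof
    assume "sat a b q \<in> closed_segment q x"
    then obtain t where t: "0 \<le> t" "t \<le> 1" "sat a b q = (1 - t) *\<^sub>R q + t *\<^sub>R x"
      unfolding in_segment by auto
    have "f (sat a b q) \<le> (1 - t) * f q + t * f x"
      unfolding t(3) using conv t(1,2) by (intro convex_onD) auto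
    also have "\<dots> \<le> (1 - t) * f x + t * f x"
      using min[of x] t by (intro add_right_mono mult_left_mono) auto
    finally show ?thesis
      by (simp add: algebra_simps)
  qed (simp add: min)
qed

lemma sat_bounds: "a \<le> b \<Longrightarrow> a \<le> sat a b q \<and> sat a b q \<le> b"
  by (auto simp: sat_def)

text \<open>The slope of \<open>C\<close> at \<open>inv (deriv C) c\<close> is \<open>c\<close>, so that point is the unconstrained minimiser of the
  tilted cost.\<close>

lemma clamped_marginal_cost_optimal:
  assumes C1: "C C1_differentiable_on UNIV" and conv: "strictly_convex C"
    and c: "c \<in> range (deriv C)"
    and x: "a \<le> x" "x \<le> b"
  defines "p \<equiv> sat a b (inv (deriv C) c)"
  shows "C p - c * p \<le> C x - c * x"
proof -
  let ?q = "inv (deriv C) c"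
  have "C differentiable at ?q"
    using C1 by (simp add: C1_differentiable_on_eq)
  then have deriv: "(C has_real_derivative c) (at ?q)"
    using c by (metis DERIV_deriv_iff_real_differentiable f_inv_into_f)
  have convex: "convex_on UNIV C"
    using conv by (rule strictly_convex_imp_convex_on)
  have "convex_on UNIV (\<lambda>x. C x - c * x)"
    using convex by (simp add: convex_on_def algebra_simps)
  then show ?thesis
    unfolding p_def using convex_min_at_slope[OF convex deriv] x
    by (rule convex_min_at_sat)
qed

lemma has_real_derivative_integral_from_0:
  fixes g :: "real \<Rightarrow> real"
  assumes "continuous_on UNIV g"
  shows "((\<lambda>u. LBINT z=0..ereal u. g z) has_real_derivative g x) (at x)"
proof -
  let ?a = "- \<bar>x\<bar> - 1" and ?b = "\<bar>x\<bar> + 1"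
  have "((\<lambda>u. LBINT z=ereal 0..ereal u. g z) has_vector_derivative g x) (at x within {?a..?b})"
    by (rule interval_integral_FTC2) (auto intro: continuous_on_subset[OF assms])
  moreover have "at x within {?a..?b} = at x"
    by (intro at_within_interior) (auto simp: interior_atLeastAtMost_real)
  ultimately show ?thesis
    by (simp add: has_real_derivative_iff_has_vector_derivative zero_ereal_def)
qed

text \<open>A monotone integrand has a convex primitive, and its value at \<open>x\<close> is the slope there.\<close>

lemma integral_min_at_marginal:
  fixes g :: "real \<Rightarrow> real"
  assumes diff: "\<And>z. g differentiable at z" and deriv: "\<And>z. 0 \<le> deriv g z"
  shows "(LBINT z=0..ereal x. g z) - g x * x \<le> (LBINT z=0..ereal y. g z) - g x * y"
proof -
  have "continuous_on UNIV g"
    using diff by (intro differentiable_imp_continuous_on) (simp add: differentiable_on_def)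
  then have D: "((\<lambda>u. LBINT z=0..ereal u. g z) has_real_derivative g u) (at u)" for u
    by (rule has_real_derivative_integral_from_0)
  have mono: "g u \<le> g v" if "u \<le> v" for u v
    using that
  proof (rule DERIV_nonneg_imp_nondecreasing)
    show "\<exists>d. (g has_real_derivative d) (at z) \<and> 0 \<le> d" for z
      using diff[of z] deriv[of z] DERIV_deriv_iff_real_differentiable by blast
  qed
  have "convex_on UNIV (\<lambda>u. LBINT z=0..ereal u. g z)"
    by (rule convex_on_realI[OF _ D mono]) auto
  then show ?thesis
    using D by (rule convex_min_at_slope)
qed

section \<open>Network equilibria\<close>

lemma finite_buses: "finite (buses P)"
  by (simp add: buses_def)

lemma gen_buses_subset:
  assumes "power_network P"
  shows "gen_buses P \<subseteq> buses P"
  using assms by (auto simp: power_network_def gen_buses_def buses_def)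

text \<open>Each line carries its flow out of one bus and into another, so it contributes zero in
  total.\<close>

lemma sum_net_inflow:
  assumes "power_network P"
  shows "(\<Sum>j\<in>buses P. net_inflow P p j) = 0"
proof -
  have E: "edges P \<subseteq> buses P \<times> buses P"
    using assms by (simp add: power_network_def)
  have fin: "finite {k. (j, k) \<in> edges P}" "finite {i. (i, j) \<in> edges P}" for j
    by (rule finite_subset[OF _ finite_buses[of P]], use E in auto)+
  have "(\<Sum>j\<in>buses P. \<Sum>k | (j, k) \<in> edges P. p (j, k)) = sum p (edges P)"
    using E fin finite_buses[of P] by (subst sum.Sigma) (auto intro!: sum.cong)
  moreover have "(\<Sum>j\<in>buses P. \<Sum>i | (i, j) \<in> edges P. p (i, j)) = sum p (edges P)"
  proof -
    have "(\<Sum>j\<in>buses P. \<Sum>i | (i, j) \<in> edges P. p (i, j)) =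
        (\<Sum>(j, i)\<in>(SIGMA j:buses P. {i. (i, j) \<in> edges P}). p (i, j))"
      using fin finite_buses[of P] by (subst sum.Sigma) auto
    also have "\<dots> = sum p (edges P)"
      by (rule sum.reindex_bij_witness[where i = prod.swap and j = prod.swap])
        (use E in auto)
    finally show ?thesis .
  qed
  ultimately show ?thesis
    by (simp add: net_inflow_def sum_subtractf)
qed

lemma equilibrium_frequency_synchronous:
  assumes "power_network P" and "network_equilibrium P \<eta> \<omega> xM xc xu"
    and "i \<in> buses P" "j \<in> buses P"
  shows "\<omega> i = \<omega> j"
proof -
  have "(i, j) \<in> (edges P \<union> (edges P)\<inverse>)\<^sup>*"
    using assms by (simp add: power_network_def)
  then show ?thesis
  proof (induction rule: rtrancl_induct)
    case (step k l)
    have "\<omega> k = \<omega> l"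
      using assms(2) step.hyps(2) by (auto simp: network_equilibrium_def Let_def)
    with step.IH show ?case
      by simp
  qed simp
qed

lemma equilibrium_power_balance:
  assumes net: "power_network P" and eq: "network_equilibrium P \<eta> \<omega> xM xc xu"
  shows "(\<Sum>j\<in>gen_buses P. k_y (gen_sys P j) (- \<omega> j)) =
    (\<Sum>j\<in>buses P. k_y (cdem_sys P j) (- \<omega> j) + k_y (udem_sys P j) (- \<omega> j) + p_load P j)"
    (is "sum ?p _ = sum ?d _")
proof -
  have bus: "(if j \<in> gen_buses P then ?p j else 0) = ?d j - net_inflow P (line_flow P \<eta>) j"
    if "j \<in> buses P" for j
  proof (cases "j \<in> gen_buses P")
    case True
    then show ?thesis
      using eq by (auto simp: network_equilibrium_def Let_def algebra_simps)
  next
    case False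
    with that have "j \<in> load_buses P"
      by (auto simp: buses_def gen_buses_def load_buses_def)
    with False show ?thesis
      using eq by (auto simp: network_equilibrium_def Let_def algebra_simps)
  qed
  have "sum ?p (gen_buses P) = (\<Sum>j\<in>buses P. if j \<in> gen_buses P then ?p j else 0)"
    using gen_buses_subset[OF net] finite_buses[of P]
    by (simp add: sum.inter_restrict[symmetric] inf.absorb2)
  also have "\<dots> = (\<Sum>j\<in>buses P. ?d j - net_inflow P (line_flow P \<eta>) j)"
    by (intro sum.cong refl bus)
  also have "\<dots> = sum ?d (buses P)"
    by (simp only: sum_subtractf sum_net_inflow[OF net] diff_zero)
  finally show ?thesis .
qed

section \<open>Optimality\<close>

text \<open>Lagrangian sufficiency: adding \<open>w\<close> times the supply surplus, zero at feasible points, makes the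
  objective a sum of independent terms and a constant, so minimising each of them minimises the cost.\<close>

lemma lagrangian_optimal:
  fixes w :: real
  assumes feasible: "oslc_feasible P Q (pM, dc, du)"
    and gen: "\<And>j x. j \<in> gen_buses P \<Longrightarrow> pM_min Q j \<le> x \<Longrightarrow> x \<le> pM_max Q j \<Longrightarrow>
      gen_cost Q j (pM j) + w * pM j \<le> gen_cost Q j x + w * x"
    and dem: "\<And>j x. j \<in> buses P \<Longrightarrow> dc_min Q j \<le> x \<Longrightarrow> x \<le> dc_max Q j \<Longrightarrow>
      dem_cost Q j (dc j) - w * dc j \<le> dem_cost Q j x - w * x"
    and unc: "\<And>j x. j \<in> buses P \<Longrightarrow>
      (LBINT z=0..ereal (du j). inv (h P j) z) - w * du j \<le>
      (LBINT z=0..ereal x. inv (h P j) z) - w * x"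
  shows "oslc_optimal P Q pM dc du"
proof -
  define A where "A = (\<lambda>j x. gen_cost Q j x + w * x)"
  define B where "B = (\<lambda>j x u. dem_cost Q j x - w * x +
    ((LBINT z=0..ereal u. inv (h P j) z) - w * u))"
  have cost: "oslc_cost P Q (p, d, u) =
      (\<Sum>j\<in>gen_buses P. A j (p j)) + (\<Sum>j\<in>buses P. B j (d j) (u j)) -
      w * (\<Sum>j\<in>buses P. p_load P j)"
    if "oslc_feasible P Q (p, d, u)" for p d u
  proof -
    have "w * (\<Sum>j\<in>gen_buses P. p j) = w * (\<Sum>j\<in>buses P. d j + u j + p_load P j)"
      using that by (simp add: oslc_feasible_def)
    then show ?thesis
      by (simp add: oslc_cost_def A_def B_def sum.distrib sum_subtractf sum_distrib_left
          algebra_simps)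
  qed
  have "oslc_cost P Q (pM, dc, du) \<le> oslc_cost P Q (p, d, u)"
    if f: "oslc_feasible P Q (p, d, u)" for p d u
  proof -
    have "(\<Sum>j\<in>gen_buses P. A j (pM j)) \<le> (\<Sum>j\<in>gen_buses P. A j (p j))"
      using f gen by (intro sum_mono) (auto simp: A_def oslc_feasible_def)
    moreover have "(\<Sum>j\<in>buses P. B j (dc j) (du j)) \<le> (\<Sum>j\<in>buses P. B j (d j) (u j))"
      unfolding B_def using f dem unc by (intro sum_mono add_mono) (auto simp: oslc_feasible_def)
    ultimately show ?thesis
      unfolding cost[OF f] cost[OF feasible] by simp
  qed
  then show ?thesis
    using feasible by (auto simp: oslc_optimal_def is_arg_min_linorder)
qed

theorem theorem2:
  fixes P :: network and Q :: oslc_data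
    and \<eta> :: "nat \<times> nat \<Rightarrow> real" and \<omega> :: "nat \<Rightarrow> real"
    and xM xc xu :: "nat \<Rightarrow> nat \<Rightarrow> real"
  assumes network: "power_network P"
    and equilibrium: "network_equilibrium P \<eta> \<omega> xM xc xu"
    and pM_bounds: "\<forall>j\<in>gen_buses P. pM_min Q j \<le> pM_max Q j"
    and dc_bounds: "\<forall>j\<in>buses P. dc_min Q j \<le> dc_max Q j"
    and gen_cost: "\<forall>j\<in>gen_buses P.
      gen_cost Q j C1_differentiable_on UNIV \<and> strictly_convex (gen_cost Q j)"
    and dem_cost: "\<forall>j\<in>buses P.
      dem_cost Q j C1_differentiable_on UNIV \<and> strictly_convex (dem_cost Q j)"
    and h_inverse: "\<forall>j\<in>buses P. bij (h P j) \<and> (\<forall>z. inv (h P j) differentiable at z)"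
    and h_inverse_deriv: "\<forall>j\<in>buses P. \<forall>z. 0 \<le> deriv (inv (h P j)) z"
    and gen_inverse_defined: "\<forall>j\<in>gen_buses P. - \<omega> j \<in> range (deriv (gen_cost Q j))"
    and dem_inverse_defined: "\<forall>j\<in>buses P. \<omega> j \<in> range (deriv (dem_cost Q j))"
    and gen_control: "\<forall>j\<in>gen_buses P.
      k_y (gen_sys P j) (- \<omega> j) =
        sat (pM_min Q j) (pM_max Q j) (inv (deriv (gen_cost Q j)) (- \<omega> j))"
    and dem_control: "\<forall>j\<in>buses P.
      k_y (cdem_sys P j) (- \<omega> j) =
        sat (dc_min Q j) (dc_max Q j) (inv (deriv (dem_cost Q j)) (\<omega> j))"
  shows "oslc_optimal P Q
    (\<lambda>j. k_y (gen_sys P j) (- \<omega> j))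
    (\<lambda>j. k_y (cdem_sys P j) (- \<omega> j))
    (\<lambda>j. k_y (udem_sys P j) (- \<omega> j))"
proof -
  define w where "w = \<omega> 1"
  have "1 \<in> buses P"
    using network by (simp add: power_network_def buses_def)
  then have sync: "\<omega> j = w" if "j \<in> buses P" for j
    unfolding w_def using that equilibrium_frequency_synchronous[OF network equilibrium] by blast
  have sync_gen: "\<omega> j = w" if "j \<in> gen_buses P" for j
    using that sync gen_buses_subset[OF network] by blast
  show ?thesis
  proof (rule lagrangian_optimal[where w = w])
    show "oslc_feasible P Q (\<lambda>j. k_y (gen_sys P j) (- \<omega> j), \<lambda>j. k_y (cdem_sys P j) (- \<omega> j),
        \<lambda>j. k_y (udem_sys P j) (- \<omega> j))"
      using equilibrium_power_balance[OF network equilibrium] pM_bounds dc_bounds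
        gen_control dem_control
      by (auto simp: oslc_feasible_def sat_bounds)
  next
    fix j x
    assume j: "j \<in> gen_buses P" and x: "pM_min Q j \<le> x" "x \<le> pM_max Q j"
    then show "gen_cost Q j (k_y (gen_sys P j) (- \<omega> j)) + w * k_y (gen_sys P j) (- \<omega> j)
        \<le> gen_cost Q j x + w * x"
      using clamped_marginal_cost_optimal[of "gen_cost Q j" "- \<omega> j", OF _ _ _ x]
        bspec[OF gen_cost j] bspec[OF gen_inverse_defined j] bspec[OF gen_control j] sync_gen[OF j]
      by simp
  next
    fix j x
    assume j: "j \<in> buses P" and x: "dc_min Q j \<le> x" "x \<le> dc_max Q j"
    then show "dem_cost Q j (k_y (cdem_sys P j) (- \<omega> j)) - w * k_y (cdem_sys P j) (- \<omega> j)
        \<le> dem_cost Q j x - w * x"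
      using clamped_marginal_cost_optimal[of "dem_cost Q j" "\<omega> j", OF _ _ _ x]
        bspec[OF dem_cost j] bspec[OF dem_inverse_defined j] bspec[OF dem_control j] sync[OF j]
      by simp
  next
    fix j x
    assume j: "j \<in> buses P"
    have du: "k_y (udem_sys P j) (- \<omega> j) = h P j w"
      by (simp add: h_def sync[OF j])
    have "inv (h P j) (h P j w) = w"
      using h_inverse j by (simp add: bij_is_inj)
    then show "(LBINT z=0..ereal (k_y (udem_sys P j) (- \<omega> j)). inv (h P j) z) -
          w * k_y (udem_sys P j) (- \<omega> j)
        \<le> (LBINT z=0..ereal x. inv (h P j) z) - w * x"
      unfolding du using integral_min_at_marginal[of "inv (h P j)" "h P j w" x]
        h_inverse h_inverse_deriv j by simp
  qed
qed

end
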